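(* Let $A\in\mathbb{C}^{m\times m}$, $v\in\mathbb{C}^m$, and let $\Xi=\{\xi_1,\dots,\xi_{m-1}\}\subset\overline{\mathbb{C}}=\mathbb{C}\cup\{\infty\}$ be poles. Let $V\in\mathbb{C}^{m\times m}$ be an orthonormal nested basis for the rational Krylov subspace $\mathcal{K}_m(A,v;\Xi)$. Then the orthogonal projection of $A$ onto this subspace can be represented by two inv-Hessenberg matrices, i.e., there exist inv-Hessenberg matrices $H^{\mathrm{inv}},K^{\mathrm{inv}}\in\mathbb{C}^{m\times m}$, with $K^{\mathrm{inv}}$ nonsingular, such that $$V^HAVK^{\mathrm{inv}}=H^{\mathrm{inv}}.$$
   Context: $(\cdot)^H$ denotes the conjugate transpose; $\|v\|_2=1$. Rational Krylov subspaces: $\mathcal{K}_1=\mathrm{span}\{v\}$, and for $k\ge 1$, $\mathcal{K}_{k+1}=\mathcal{K}_k+(A-\xi_kI)^{-1}\mathcal{K}_k$ if $\xi_k$ is finite, and $\mathcal{K}_{k+1}=\mathcal{K}_k+A\mathcal{K}_k$ if $\xi_k=\infty$. Finite poles are not eigenvalues of $A$. Equivalently, $\mathcal{K}_k(A,v;\Xi)=q_{k-1}(A)^{-1}\,\mathrm{span}\{v,Av,\dots,A^{k-1}v\}$ with $q_{k-1}(z)=\prod_{i\le k-1,\ \xi_i\neq\infty}(z-\xi_i)$. It is assumed throughout that no breakdowns occur, i.e., $\dim\mathcal{K}_k=k$ for $k=1,\dots,m$. A basis $V$ is nested if for each $i$ its first $i$ columns span $\mathcal{K}_i$; it is orthonormal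 if $V^HV=I$. A core transformation $C_i\in\mathbb{C}^{m\times m}$ ($1\le i\le m-1$) is a unitary matrix equal to the identity except for a $2\times 2$ unitary block in rows and columns $i,i+1$. An inv-Hessenberg matrix is a matrix of the form $QR$ with $Q=C_{m-1}C_{m-2}\cdots C_1$ (an ascending pattern of core transformations) and $R$ upper triangular (it need not be invertible). A pencil $(H,K)$ represents the projection $V^HAV$ if $K$ is nonsingular and $V^HAVK=H$. *)

theory Defs
  imports "Jordan_Normal_Form.Schur_Decomposition" "Jordan_Normal_Form.VS_Connect"
    "Jordan_Normal_Form.Gauss_Jordan_Elimination"
begin

definition vec_norm2 :: "complex vec \<Rightarrow> real" where
  "vec_norm2 v = sqrt (\<Sum>i<dim_vec v. (cmod (v $ i))\<^sup>2)"

definition cspan :: "nat \<Rightarrow> complex vec set \<Rightarrow> complex vec set" where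
  "cspan n S = LinearCombinations.module.span class_ring (module_vec TYPE(complex) n) S"

text \<open>Dimension of a linear subspace \<open>W\<close> of the space of complex vectors of length \<open>n\<close>.\<close>

definition csubspace_dim :: "nat \<Rightarrow> complex vec set \<Rightarrow> nat" where
  "csubspace_dim n W =
     vectorspace.dim class_ring ((module_vec TYPE(complex) n)\<lparr>carrier := W\<rparr>)"

text \<open>A pole is a point of the extended complex plane; \<open>None\<close> stands for infinity.\<close>

type_synonym pole = "complex option"

text \<open>The library's \<open>mat_inverse\<close> returns \<open>Some\<close> of the inverse when the matrix is
  invertible, so the finite case below is meaningful only if \<open>z\<close> is not an eigenvalue of \<open>A\<close>.\<close>

definition krylov_op :: "complex mat \<Rightarrow> pole \<Rightarrow> complex mat" where
  "krylov_op A p = (case p of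
       None \<Rightarrow> A
     | Some z \<Rightarrow> the (mat_inverse (A - z \<cdot>\<^sub>m 1\<^sub>m (dim_row A))))"

text \<open>The argument \<open>\<xi> i\<close> is the \<open>i\<close>-th pole, with indices starting at 1. The spaces are
  indexed from 1 as well; index 0 is the zero space and only makes the function total.\<close>

fun rat_krylov :: "complex mat \<Rightarrow> complex vec \<Rightarrow> (nat \<Rightarrow> pole) \<Rightarrow> nat \<Rightarrow> complex vec set" where
  "rat_krylov A v \<xi> 0 = cspan (dim_row A) {}"
| "rat_krylov A v \<xi> (Suc 0) = cspan (dim_row A) {v}"
| "rat_krylov A v \<xi> (Suc (Suc k)) =
     {x + krylov_op A (\<xi> (Suc k)) *\<^sub>v y | x y.
        x \<in> rat_krylov A v \<xi> (Suc k) \<and> y \<in> rat_krylov A v \<xi> (Suc k)}"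

text \<open>Linear independence of the columns is implied by \<open>V\<^sup>H V = I\<close>.\<close>

definition orthonormal_nested_basis ::
  "nat \<Rightarrow> complex mat \<Rightarrow> complex vec \<Rightarrow> (nat \<Rightarrow> pole) \<Rightarrow> complex mat \<Rightarrow> bool" where
  "orthonormal_nested_basis m A v \<xi> V \<longleftrightarrow>
     V \<in> carrier_mat m m \<and>
     mat_adjoint V * V = 1\<^sub>m m \<and>
     (\<forall>i\<in>{1..m}. cspan m (set (take i (cols V))) = rat_krylov A v \<xi> i)"

definition unitary_mat :: "nat \<Rightarrow> complex mat \<Rightarrow> bool" where
  "unitary_mat m U \<longleftrightarrow>
     U \<in> carrier_mat m m \<and> mat_adjoint U * U = 1\<^sub>m m \<and> U * mat_adjoint U = 1\<^sub>m m"

text \<open>The index \<open>i\<close> ranges over \<open>1, ..., m - 1\<close>. Matrix entries are indexed from 0, so the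
  active rows and columns \<open>i, i + 1\<close> have the indices \<open>i - 1\<close> and \<open>i\<close>. The active block is
  unitary because the whole matrix is.\<close>

definition core_transformation :: "nat \<Rightarrow> nat \<Rightarrow> complex mat \<Rightarrow> bool" where
  "core_transformation m i C \<longleftrightarrow>
     1 \<le> i \<and> i \<le> m - 1 \<and> unitary_mat m C \<and>
     (\<forall>r<m. \<forall>c<m. \<not> (r \<in> {i - 1, i} \<and> c \<in> {i - 1, i}) \<longrightarrow> C $$ (r, c) = 1\<^sub>m m $$ (r, c))"

text \<open>\<open>ascending_prod m C k\<close> is \<open>C k * ... * C 2 * C 1\<close>.\<close>

primrec ascending_prod :: "nat \<Rightarrow> (nat \<Rightarrow> complex mat) \<Rightarrow> nat \<Rightarrow> complex mat" where
  "ascending_prod m C 0 = 1\<^sub>m m"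
| "ascending_prod m C (Suc k) = C (Suc k) * ascending_prod m C k"

definition inv_hessenberg :: "nat \<Rightarrow> complex mat \<Rightarrow> bool" where
  "inv_hessenberg m X \<longleftrightarrow>
     (\<exists>C R. (\<forall>i\<in>{1..m - 1}. core_transformation m i (C i)) \<and>
            R \<in> carrier_mat m m \<and> upper_triangular R \<and>
            X = ascending_prod m C (m - 1) * R)"

end

theory Submission
  imports Defs
begin

text \<open>
  In the coordinates of \<open>V\<close> the Krylov spaces become \<open>E\<^sub>j = span(e\<^sub>1, \<dots>, e\<^sub>j)\<close>, and \<open>A\<close> becomes
  \<open>B = V\<^sup>H A V\<close>. Whatever the pole \<open>\<xi>\<^sub>j\<close> is, \<open>E\<^sub>j + B E\<^sub>j\<close> has dimension \<open>j + 1\<close> for \<open>1 \<le> j < m\<close>. A matrix is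
  inv-Hessenberg as soon as, for every \<open>i\<close>, its block of rows \<open>\<ge> i\<close> and columns \<open>\<le> i\<close> has rank at
  most one. For \<open>K\<close> this holds if its first \<open>i\<close> columns span \<open>E\<^bsub>i-1\<^esub> + span(f\<^sub>i)\<close>, and for \<open>H = B K\<close>
  if moreover \<open>B f\<^sub>i\<close> lies in \<open>E\<^bsub>i-1\<^esub> + B E\<^bsub>i-1\<^esub>\<close> for \<open>i \<ge> 2\<close>. We start with \<open>f\<^sub>1 = e\<^sub>1\<close>.
  A dimension count gives such an \<open>f\<^sub>i\<close> outside
  \<open>E\<^bsub>i-1\<^esub>\<close>; the same vector is kept for \<open>i + 1\<close> until \<open>E\<^sub>i\<close> absorbs it, and only then a new one is
  chosen, so that the column spaces are nested. The choice \<open>K = [f, e\<^sub>1, \<dots>, e\<^bsub>m-1\<^esub>]\<close> with a single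
  vector \<open>f\<close> fails in general, for instance when \<open>\<xi>\<^sub>1 = 0\<close> and \<open>m \<ge> 3\<close>.
\<close>

subsection \<open>Rank-one lower blocks and core transformations\<close>

lemma mat_adjoint_index:
  fixes A :: "complex mat"
  assumes "i < dim_col A" "j < dim_row A"
  shows "mat_adjoint A $$ (i, j) = cnj (A $$ (j, i))"
  using assms by (simp add: mat_adjoint_def mat_of_rows_index)

lemma mat_adjoint_dim [simp]:
  fixes A :: "complex mat"
  shows "dim_row (mat_adjoint A) = dim_col A" "dim_col (mat_adjoint A) = dim_row A"
  by (simp_all add: mat_adjoint_def)

text \<open>The active block has the rows \<open>(a, - cnj b)\<close> and \<open>(b, cnj a)\<close>,
  so it is unitary once the squared moduli of \<open>a\<close> and \<open>b\<close> add up to 1. As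
  \<open>k\<close> counts from 0, this is a core transformation with index
  \<open>Suc k\<close>.\<close>

definition core :: "nat \<Rightarrow> nat \<Rightarrow> complex \<Rightarrow> complex \<Rightarrow> complex mat" where
  "core m k a b = mat m m (\<lambda>(r, c).
     if r = k \<and> c = k then a else if r = k \<and> c = Suc k then - cnj b
     else if r = Suc k \<and> c = k then b else if r = Suc k \<and> c = Suc k then cnj a
     else if r = c then 1 else 0)"

lemma core_carrier [simp]: "core m k a b \<in> carrier_mat m m"
  by (simp add: core_def)

lemma core_dim [simp]: "dim_row (core m k a b) = m" "dim_col (core m k a b) = m"
  by (simp_all add: core_def)

lemma core_mult_index:
  assumes Y: "Y \<in> carrier_mat m n" and k: "Suc k < m" and r: "r < m" and c: "c < n"
  shows "(core m k a b * Y) $$ (r, c) =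
    (if r = k then a * Y $$ (k, c) - cnj b * Y $$ (Suc k, c)
     else if r = Suc k then b * Y $$ (k, c) + cnj a * Y $$ (Suc k, c) else Y $$ (r, c))"
proof -
  have "(core m k a b * Y) $$ (r, c) = (\<Sum>i\<in>{0..<m}. core m k a b $$ (r, i) * Y $$ (i, c))"
    using Y r c by (simp add: scalar_prod_def)
  also have "\<dots> = (\<Sum>i\<in>{0..<m}.
      if r = k then (if i = k then a * Y $$ (k, c) else 0)
        + (if i = Suc k then - cnj b * Y $$ (Suc k, c) else 0)
      else if r = Suc k then (if i = k then b * Y $$ (k, c) else 0)
        + (if i = Suc k then cnj a * Y $$ (Suc k, c) else 0)
      else (if i = r then Y $$ (r, c) else 0))"
    using r by (intro sum.cong) (auto simp: core_def)
  also have "\<dots> = (if r = k then a * Y $$ (k, c) - cnj b * Y $$ (Suc k, c)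
     else if r = Suc k then b * Y $$ (k, c) + cnj a * Y $$ (Suc k, c) else Y $$ (r, c))"
    using k r by (auto simp: sum.distrib)
  finally show ?thesis .
qed

lemma mat_adjoint_core: "mat_adjoint (core m k a b) = core m k (cnj a) (- b)"
  by (rule eq_matI) (auto simp: mat_adjoint_index, auto simp: core_def)

lemma core_inverse:
  assumes k: "Suc k < m" and ab: "cnj a * a + cnj b * b = 1"
  shows "core m k (cnj a) (- b) * core m k a b = 1\<^sub>m m"
proof (rule eq_matI)
  fix i j assume "i < dim_row (1\<^sub>m m :: complex mat)" "j < dim_col (1\<^sub>m m :: complex mat)"
  hence ij: "i < m" "j < m" by auto
  have ab': "b * cnj b + a * cnj a = 1"
    using ab by (simp add: mult.commute[of "cnj _"] add.commute)
  show "(core m k (cnj a) (- b) * core m k a b) $$ (i, j) = 1\<^sub>m m $$ (i, j)"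
    using k ij unfolding core_mult_index[OF core_carrier k ij]
    by (auto simp: core_def ab ab' mult.commute[of b a] mult.commute[of "cnj b" "cnj a"])
qed auto

lemma core_transformation_core:
  assumes k: "Suc k < m" and ab: "cnj a * a + cnj b * b = 1"
  shows "core_transformation m (Suc k) (core m k a b)"
proof -
  have "core m k a b * core m k (cnj a) (- b) = 1\<^sub>m m"
    using core_inverse[OF k, of "cnj a" "- b"] ab by (simp add: mult.commute)
  thus ?thesis
    using core_inverse[OF k ab] k
    unfolding core_transformation_def unitary_mat_def mat_adjoint_core
    by (auto simp: core_def)
qed

text \<open>The pair \<open>(a, b)\<close> is \<open>(x, y)\<close> scaled to unit length, or
  \<open>(1, 0)\<close> if both vanish. The second equation says that the adjoint rotation
  annihilates the second entry of \<open>(x, y)\<close>.\<close>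

lemma rotation_exists:
  fixes x y :: complex
  obtains a b where "cnj a * a + cnj b * b = 1" "a * y = b * x"
proof (cases "x = 0 \<and> y = 0")
  case True
  thus ?thesis using that[of 1 0] by simp
next
  case False
  define n where "n = sqrt ((cmod x)\<^sup>2 + (cmod y)\<^sup>2)"
  have n: "n\<^sup>2 = (cmod x)\<^sup>2 + (cmod y)\<^sup>2" "n\<^sup>2 \<noteq> 0"
    using False by (auto simp: n_def sum_power2_eq_zero_iff)
  have "cnj (x / of_real n) * (x / of_real n) + cnj (y / of_real n) * (y / of_real n)
      = (cnj x * x + cnj y * y) / of_real (n\<^sup>2)"
    by (simp add: power2_eq_square add_divide_distrib)
  also have "cnj x * x + cnj y * y = of_real (n\<^sup>2)"
    unfolding n(1) by (simp add: complex_norm_square[symmetric] mult.commute[of "cnj _"] flip: of_real_power)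
  finally have "cnj (x / of_real n) * (x / of_real n) + cnj (y / of_real n) * (y / of_real n) = 1"
    using n(2) by simp
  thus ?thesis by (rule that) simp
qed

section \<open>Ascending products and rank-one lower blocks\<close>

lemma ascending_prod_carrier:
  assumes "\<And>i. i \<in> {1..k} \<Longrightarrow> C i \<in> carrier_mat m m"
  shows "ascending_prod m C k \<in> carrier_mat m m"
  using assms
proof (induction k)
  case (Suc k)
  hence "C (Suc k) \<in> carrier_mat m m" "ascending_prod m C k \<in> carrier_mat m m" by auto
  thus ?case by simp
qed simp

lemma ascending_prod_cong:
  assumes "\<And>i. i \<in> {1..k} \<Longrightarrow> C i = D i"
  shows "ascending_prod m C k = ascending_prod m D k"
  using assms by (induction k) auto

text \<open>Rank at most one is written as an outer product so that a row operation acts on the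
  factor \<open>w\<close> alone. The upper right corner of the block is the diagonal entry
  \<open>(i, i)\<close>.\<close>

definition lower_rank1 :: "nat \<Rightarrow> nat \<Rightarrow> complex mat \<Rightarrow> bool" where
  "lower_rank1 m i X \<longleftrightarrow>
     (\<exists>w c. \<forall>r s. i \<le> r \<and> r < m \<and> s \<le> i \<longrightarrow> X $$ (r, s) = w r * c s)"

text \<open>The subdiagonal part is annihilated from the bottom row upwards; rotating the rows
  \<open>k\<close> and \<open>k + 1\<close> clears row \<open>k + 1\<close> because of the rank-one structure, and it preserves that
  structure in the blocks further up.\<close>

lemma ascending_factorization:
  assumes "X \<in> carrier_mat m m" "k < m"
    and "\<And>i. i < k \<Longrightarrow> lower_rank1 m i X"
    and "\<And>r s. k < r \<Longrightarrow> r < m \<Longrightarrow> s < r \<Longrightarrow> X $$ (r, s) = 0"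
  shows "\<exists>C R. (\<forall>i\<in>{1..k}. core_transformation m i (C i)) \<and>
    R \<in> carrier_mat m m \<and> upper_triangular R \<and> X = ascending_prod m C k * R"
  using assms
proof (induction k arbitrary: X)
  case 0
  have "upper_triangular X" using 0 by (auto simp: upper_triangular_def)
  thus ?case using 0(1) by (auto intro!: exI[of _ X])
next
  case (Suc k)
  note X = Suc.prems(1) and k = Suc.prems(2)
  from Suc.prems(3)[of k] obtain w c where
    wc: "\<And>r s. k \<le> r \<Longrightarrow> r < m \<Longrightarrow> s \<le> k \<Longrightarrow> X $$ (r, s) = w r * c s"
    unfolding lower_rank1_def by auto
  obtain a b where ab: "cnj a * a + cnj b * b = 1" "a * w (Suc k) = b * w k"
    by (rule rotation_exists)
  define D where "D = core m k a b"
  define D' where "D' = core m k (cnj a) (- b)"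
  define Y where "Y = D' * X"
  have Y: "Y \<in> carrier_mat m m" using X unfolding Y_def D'_def by (intro mult_carrier_mat) auto
  have D: "D \<in> carrier_mat m m" by (simp add: D_def)
  have D': "D' \<in> carrier_mat m m" by (simp add: D'_def)
  have DD: "D * D' = 1\<^sub>m m"
    using core_inverse[OF k, of "cnj a" "- b"] ab by (simp add: mult.commute D_def D'_def)
  have Y_ix: "Y $$ (r, s) = (if r = k then cnj a * X $$ (k, s) + cnj b * X $$ (Suc k, s)
      else if r = Suc k then a * X $$ (Suc k, s) - b * X $$ (k, s) else X $$ (r, s))"
    if "r < m" "s < m" for r s
    unfolding Y_def D'_def core_mult_index[OF X k that] by simp
  have "\<exists>C R. (\<forall>i\<in>{1..k}. core_transformation m i (C i)) \<and>
    R \<in> carrier_mat m m \<and> upper_triangular R \<and> Y = ascending_prod m C k * R"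
  proof (rule Suc.IH[OF Y])
    show "k < m" using k by simp
  next
    fix i assume i: "i < k"
    then obtain u d where
      ud: "\<And>r s. i \<le> r \<Longrightarrow> r < m \<Longrightarrow> s \<le> i \<Longrightarrow> X $$ (r, s) = u r * d s"
      using Suc.prems(3)[of i] unfolding lower_rank1_def by auto
    \<comment> \<open>Both rotated rows lie in this block because \<open>i < k\<close>, so only its
      column factor changes.\<close>
    define u' where "u' r = (if r = k then cnj a * u k + cnj b * u (Suc k)
      else if r = Suc k then a * u (Suc k) - b * u k else u r)" for r
    have "Y $$ (r, s) = u' r * d s" if "i \<le> r" "r < m" "s \<le> i" for r s
      using that i k by (simp add: Y_ix ud u'_def algebra_simps)
    thus "lower_rank1 m i Y" unfolding lower_rank1_def by blast
  next
    fix r s assume rs: "k < r" "r < m" "s < r"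
    show "Y $$ (r, s) = 0"
    proof (cases "r = Suc k")
      case True
      have "a * (w (Suc k) * c s) - b * (w k * c s) = (a * w (Suc k) - b * w k) * c s"
        by (simp add: algebra_simps)
      also have "\<dots> = 0" using ab(2) by simp
      finally have "a * (w (Suc k) * c s) - b * (w k * c s) = 0" .
      thus ?thesis using rs True k by (simp add: Y_ix wc)
    next
      case False
      thus ?thesis using rs Suc.prems(4)[of r s] by (simp add: Y_ix)
    qed
  qed
  then obtain C R where C: "\<forall>i\<in>{1..k}. core_transformation m i (C i)"
    and R: "R \<in> carrier_mat m m" "upper_triangular R" and YR: "Y = ascending_prod m C k * R"
    by blast
  \<comment> \<open>Undoing the rotation multiplies by \<open>D\<close> from the left, so
    \<open>D\<close> receives the largest index of the ascending product.\<close>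
  define C' where "C' = C(Suc k := D)"
  have asc: "ascending_prod m C k \<in> carrier_mat m m"
    using C by (intro ascending_prod_carrier) (auto simp: core_transformation_def unitary_mat_def)
  have "ascending_prod m C' k = ascending_prod m C k"
    by (rule ascending_prod_cong) (auto simp: C'_def)
  hence "ascending_prod m C' (Suc k) * R = D * Y"
    using assoc_mult_mat[OF D asc R(1)] by (simp add: C'_def YR)
  also have "\<dots> = X"
    unfolding Y_def using assoc_mult_mat[OF D D' X] X by (simp add: DD)
  finally have "X = ascending_prod m C' (Suc k) * R" ..
  moreover have "\<forall>i\<in>{1..Suc k}. core_transformation m i (C' i)"
    using C core_transformation_core[OF k ab(1)] by (auto simp: C'_def D_def)
  ultimately show ?case using R by blast
qed

text \<open>The factorization is taken at \<open>k = m - 1\<close>, where the condition on the rows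
  below \<open>k\<close> is vacuous.\<close>

lemma inv_hessenberg_if_lower_rank1:
  assumes "X \<in> carrier_mat m m" "m \<noteq> 0"
    and "\<And>i. i < m \<Longrightarrow> lower_rank1 m i X"
  shows "inv_hessenberg m X"
  unfolding inv_hessenberg_def
  by (rule ascending_factorization) (use assms in auto)

section \<open>Linear systems for dimension counts, and invertibility\<close>

lemma underdetermined_solution:
  fixes a :: "nat \<Rightarrow> nat \<Rightarrow> 'a :: field"
  obtains c where "\<exists>k\<le>n. c k \<noteq> 0" "\<And>i. i < n \<Longrightarrow> (\<Sum>k\<le>n. a i k * c k) = 0"
proof -
  \<comment> \<open>An additional zero row makes the system square and singular.\<close>
  define M where "M = mat\<^sub>r (Suc n) (Suc n) (\<lambda>i. if i = n then 0\<^sub>v (Suc n) else vec (Suc n) (a i))"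
  have M: "M \<in> carrier_mat (Suc n) (Suc n)" by (simp add: M_def)
  have "det M = 0" unfolding M_def by (rule det_row_0) auto
  then obtain v where v: "v \<in> carrier_vec (Suc n)" "v \<noteq> 0\<^sub>v (Suc n)" "M *\<^sub>v v = 0\<^sub>v (Suc n)"
    using det_0_iff_vec_prod_zero[OF M] by blast
  have nz: "\<exists>k\<le>n. v $ k \<noteq> 0"
  proof (rule ccontr)
    assume "\<not> ?thesis"
    hence "v = 0\<^sub>v (Suc n)" using v(1) by (intro eq_vecI) auto
    thus False using v(2) by simp
  qed
  have "(\<Sum>k\<le>n. a i k * v $ k) = 0" if i: "i < n" for i
  proof -
    have "(\<Sum>k\<le>n. a i k * v $ k) = (M *\<^sub>v v) $ i"
      using i v(1) by (simp add: M_def scalar_prod_def atLeast0LessThan lessThan_Suc_atMost)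
    thus ?thesis using v(3) i by simp
  qed
  thus ?thesis using nz that by blast
qed

text \<open>Preimages of the unit vectors form a right inverse, which for a square matrix is
  two-sided.\<close>

lemma invertible_if_surjective:
  fixes K :: "complex mat"
  assumes K: "K \<in> carrier_mat m m"
    and sur: "carrier_vec m \<subseteq> (\<lambda>x. K *\<^sub>v x) ` carrier_vec m"
  shows "invertible_mat K"
proof -
  have "\<forall>i. \<exists>x \<in> carrier_vec m. K *\<^sub>v x = unit_vec m i"
    using sur by (metis image_iff subsetD unit_vec_carrier)
  then obtain f where f: "\<And>i. f i \<in> carrier_vec m" "\<And>i. K *\<^sub>v f i = unit_vec m i" by metis
  define R where "R = mat_of_cols m (map f [0..<m])"
  have R: "R \<in> carrier_mat m m" by (simp add: R_def mat_of_cols_def)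
  have "K * R = 1\<^sub>m m"
  proof (rule mat_col_eqI)
    fix i assume "i < dim_col (1\<^sub>m m :: complex mat)"
    hence i: "i < m" by simp
    have "col (K * R) i = K *\<^sub>v col R i" using i K R by (intro col_mult2) auto
    also have "col R i = f i" using i f(1) unfolding R_def by (subst col_mat_of_cols) auto
    finally show "col (K * R) i = col (1\<^sub>m m) i" using i f(2) by simp
  qed (use K R in auto)
  moreover from mat_mult_left_right_inverse[OF K R this] have "R * K = 1\<^sub>m m" .
  ultimately show ?thesis
    using K R unfolding invertible_mat_def inverts_mat_def square_mat.simps by auto
qed

subsection \<open>Construction of the pencil\<close>

text \<open>This is the span E_j of the first \<open>j\<close> unit vectors, encoded by vanishing
  coordinates so that the quotient by E_j is read off from the coordinates \<open>r\<close> with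
  \<open>j \<le> r\<close>.\<close>

definition lead_space :: "nat \<Rightarrow> nat \<Rightarrow> complex vec set" where
  "lead_space m j = {x \<in> carrier_vec m. \<forall>r. j \<le> r \<and> r < m \<longrightarrow> x $ r = 0}"

lemma lead_spaceI:
  "x \<in> carrier_vec m \<Longrightarrow> (\<And>r. j \<le> r \<Longrightarrow> r < m \<Longrightarrow> x $ r = 0) \<Longrightarrow> x \<in> lead_space m j"
  by (simp add: lead_space_def)

lemma lead_space_carrier: "x \<in> lead_space m j \<Longrightarrow> x \<in> carrier_vec m"
  by (simp add: lead_space_def)

lemma lead_space_index: "x \<in> lead_space m j \<Longrightarrow> j \<le> r \<Longrightarrow> r < m \<Longrightarrow> x $ r = 0"
  by (simp add: lead_space_def)

lemma lead_space_mono: "i \<le> j \<Longrightarrow> lead_space m i \<subseteq> lead_space m j"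
  by (auto simp: lead_space_def)

lemma lead_space_zero: "0\<^sub>v m \<in> lead_space m j"
  by (simp add: lead_space_def)

lemma lead_space_add:
  "x \<in> lead_space m j \<Longrightarrow> y \<in> lead_space m j \<Longrightarrow> x + y \<in> lead_space m j"
  by (auto simp: lead_space_def)

lemma lead_space_smult: "x \<in> lead_space m j \<Longrightarrow> a \<cdot>\<^sub>v x \<in> lead_space m j"
  by (auto simp: lead_space_def)

lemma unit_vec_lead_space: "i < j \<Longrightarrow> unit_vec m i \<in> lead_space m j"
  by (simp add: lead_space_def unit_vec_def)

lemma lead_space_Suc_index_nonzero:
  assumes "x \<in> lead_space m (Suc j)" "x \<notin> lead_space m j"
  shows "x $ j \<noteq> 0"
proof
  assume "x $ j = 0"
  hence "x $ r = 0" if "j \<le> r" "r < m" for r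
    using that lead_space_index[OF assms(1), of r] by (cases "r = j") auto
  thus False using assms lead_space_carrier by (auto intro: lead_spaceI)
qed

definition sum_space :: "nat \<Rightarrow> complex mat \<Rightarrow> nat \<Rightarrow> complex vec set" where
  "sum_space m B j = {x + B *\<^sub>v y | x y. x \<in> lead_space m j \<and> y \<in> lead_space m j}"

text \<open>Modulo E_j the space \<open>sum_space m B j\<close> is the line spanned by
  \<open>w\<close>; equivalently, it has dimension \<open>j + 1\<close>.\<close>

definition rank1_growth :: "nat \<Rightarrow> complex mat \<Rightarrow> nat \<Rightarrow> bool" where
  "rank1_growth m B j \<longleftrightarrow> (\<exists>w \<in> sum_space m B j. w \<notin> lead_space m j \<and>
     (\<forall>y \<in> sum_space m B j. \<exists>\<alpha>. \<forall>r. j \<le> r \<and> r < m \<longrightarrow> y $ r = \<alpha> * w $ r))"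

context
  fixes m :: nat and B :: "complex mat"
  assumes B: "B \<in> carrier_mat m m"
begin

lemma sum_space_carrier: "x \<in> sum_space m B j \<Longrightarrow> x \<in> carrier_vec m"
  using B by (auto simp: sum_space_def dest!: lead_space_carrier)

lemma sum_space_mono: "i \<le> j \<Longrightarrow> sum_space m B i \<subseteq> sum_space m B j"
  using lead_space_mono[of i j m] unfolding sum_space_def by blast

lemma mult_in_sum_space: "y \<in> lead_space m j \<Longrightarrow> B *\<^sub>v y \<in> sum_space m B j"
proof -
  assume y: "y \<in> lead_space m j"
  have "B *\<^sub>v y = 0\<^sub>v m + B *\<^sub>v y" using B lead_space_carrier[OF y] by simp
  thus ?thesis using y lead_space_zero[of m j] unfolding sum_space_def by blast
qed

lemma sum_space_smult_add:
  assumes "z \<in> lead_space m j" "w \<in> sum_space m B j"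
  shows "z + a \<cdot>\<^sub>v w \<in> sum_space m B j"
proof -
  from assms(2) obtain x y where w: "w = x + B *\<^sub>v y"
    and xy: "x \<in> lead_space m j" "y \<in> lead_space m j"
    unfolding sum_space_def by blast
  note c = lead_space_carrier[OF xy(1)] lead_space_carrier[OF xy(2)] lead_space_carrier[OF assms(1)]
  have "z + a \<cdot>\<^sub>v w = (z + a \<cdot>\<^sub>v x) + B *\<^sub>v (a \<cdot>\<^sub>v y)"
    unfolding w mult_mat_vec[OF B c(2)]
    using B c by (intro eq_vecI) (auto simp: algebra_simps)
  thus ?thesis
    unfolding sum_space_def
    using lead_space_smult[OF xy(2), of a] lead_space_add[OF assms(1) lead_space_smult[OF xy(1), of a]]
    by blast
qed

text \<open>Discarding the first \<open>j\<close> coordinates of the image leaves \<open>m - j\<close> equations for the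
  \<open>m - j\<close> free coordinates of \<open>g\<close> and the coefficient of \<open>w\<close>.\<close>

lemma vector_mapped_into_sum_space:
  assumes w: "w \<in> sum_space m B j" "w \<notin> lead_space m j"
  shows "\<exists>g \<in> carrier_vec m. g \<notin> lead_space m j \<and> B *\<^sub>v g \<in> sum_space m B j"
proof -
  \<comment> \<open>The rows \<open>i < j\<close> say \<open>c i = 0\<close>; the others say that
    \<open>B *\<^sub>v g\<close> agrees with \<open>c m\<close> times \<open>w\<close> from
    coordinate \<open>j\<close> on. Together these are \<open>m\<close> equations in
    \<open>m + 1\<close> unknowns.\<close>
  define a where "a i k = (if i < j then (if k = i then 1 else 0)
    else if k < m then B $$ (i, k) else - w $ i)" for i k
  obtain c where c: "\<exists>k\<le>m. c k \<noteq> 0" "\<And>i. i < m \<Longrightarrow> (\<Sum>k\<le>m. a i k * c k) = 0"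
    using underdetermined_solution[where a = a and n = m] by blast
  define g where "g = vec m c"
  have g: "g \<in> carrier_vec m" by (simp add: g_def)
  have c0: "c i = 0" if "i < j" "i < m" for i
  proof -
    have "(\<Sum>k\<le>m. a i k * c k) = (\<Sum>k\<le>m. if k = i then c k else 0)"
      using that by (intro sum.cong) (auto simp: a_def)
    also have "\<dots> = c i" using that by simp
    finally show ?thesis using c(2)[OF that(2)] by simp
  qed
  have Bg: "(B *\<^sub>v g) $ i = c m * w $ i" if "j \<le> i" "i < m" for i
  proof -
    have "(B *\<^sub>v g) $ i = (\<Sum>k<m. a i k * c k)"
      using that B by (simp add: g_def scalar_prod_def a_def atLeast0LessThan)
    also have "(\<Sum>k\<le>m. a i k * c k) = (\<Sum>k<m. a i k * c k) - w $ i * c m"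
      using that by (simp add: lessThan_Suc_atMost[symmetric] a_def)
    hence "(\<Sum>k<m. a i k * c k) = c m * w $ i"
      using c(2)[OF that(2)] by (simp add: mult.commute)
    finally show ?thesis .
  qed
  \<comment> \<open>Otherwise \<open>g\<close> is zero, so the nontrivial solution has
    \<open>c m \<noteq> 0\<close>, and \<open>B *\<^sub>v g = 0\<^sub>v m\<close> forces
    \<open>w\<close> into E_j.\<close>
  have "g \<notin> lead_space m j"
  proof
    assume gj: "g \<in> lead_space m j"
    have ck: "c k = 0" if "k < m" for k
      using c0[of k] lead_space_index[OF gj, of k] that by (cases "k < j") (auto simp: g_def)
    hence "g = 0\<^sub>v m" by (auto simp: g_def)
    moreover have "c m \<noteq> 0" using c(1) ck by (metis le_neq_implies_less)
    ultimately have "w $ i = 0" if "j \<le> i" "i < m" for i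
      using Bg[OF that] B that by auto
    thus False using w sum_space_carrier by (auto intro: lead_spaceI)
  qed
  moreover have "B *\<^sub>v g \<in> sum_space m B j"
  proof -
    define z where "z = B *\<^sub>v g - c m \<cdot>\<^sub>v w"
    have wc: "w \<in> carrier_vec m" using w sum_space_carrier by blast
    have "z \<in> lead_space m j"
      using B wc g Bg by (intro lead_spaceI) (simp_all add: z_def)
    hence "z + c m \<cdot>\<^sub>v w \<in> sum_space m B j" using w(1) by (rule sum_space_smult_add)
    moreover have "z + c m \<cdot>\<^sub>v w = B *\<^sub>v g"
      using B wc g by (intro eq_vecI) (auto simp: z_def)
    ultimately show ?thesis by simp
  qed
  ultimately show ?thesis using g by blast
qed

text \<open>The vector \<open>g j\<close> is the f with index \<open>j + 1\<close> of the outline.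
  It may be kept while it stays outside the next leading space, since \<open>sum_space m B j\<close>
  grows with \<open>j\<close>; once absorbed, it is replaced by a vector from the dimension
  count.\<close>

lemma vector_sequence:
  assumes "\<And>j. 1 \<le> j \<Longrightarrow> j < m \<Longrightarrow> \<not> sum_space m B j \<subseteq> lead_space m j" and m: "m \<noteq> 0"
  obtains g where "g 0 = unit_vec m 0"
    and "\<And>j. j < m \<Longrightarrow> g j \<in> carrier_vec m \<and> g j \<notin> lead_space m j"
    and "\<And>j. 1 \<le> j \<Longrightarrow> j < m \<Longrightarrow> B *\<^sub>v g j \<in> sum_space m B j"
    and "\<And>j. Suc j < m \<Longrightarrow> g (Suc j) = g j \<or> g j \<in> lead_space m (Suc j)"
proof -
  define P where "P j x \<longleftrightarrow> (j = 0 \<longrightarrow> x = unit_vec m 0) \<and> (j < m \<longrightarrow>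
    x \<in> carrier_vec m \<and> x \<notin> lead_space m j \<and> (1 \<le> j \<longrightarrow> B *\<^sub>v x \<in> sum_space m B j))" for j x
  define Q where "Q j x y \<longleftrightarrow> (Suc j < m \<longrightarrow> y = x \<or> x \<in> lead_space m (Suc j))" for j x and y :: "complex vec"
  have "\<exists>g. \<forall>j. P j (g j) \<and> Q j (g j) (g (Suc j))"
  proof (rule dependent_nat_choice)
    show "\<exists>x. P 0 x"
      using m by (auto simp: P_def lead_space_def)
  next
    fix x j assume P: "P j x"
    show "\<exists>y. P (Suc j) y \<and> Q j x y"
    proof (cases "Suc j < m \<and> x \<in> lead_space m (Suc j)")
      case True
      then obtain w where "w \<in> sum_space m B (Suc j)" "w \<notin> lead_space m (Suc j)"
        using assms(1)[of "Suc j"] by auto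
      from vector_mapped_into_sum_space[OF this] True show ?thesis
        by (auto simp: P_def Q_def)
    next
      case False
      have "Suc j < m \<Longrightarrow> B *\<^sub>v x \<in> sum_space m B (Suc j)"
      proof (cases "j = 0")
        case True
        thus ?thesis using P
          by (auto simp: P_def intro!: mult_in_sum_space unit_vec_lead_space)
      next
        case False
        thus "Suc j < m \<Longrightarrow> ?thesis" using P sum_space_mono[of j "Suc j"]
          by (auto simp: P_def)
      qed
      thus ?thesis using False P by (intro exI[of _ x]) (auto simp: P_def Q_def)
    qed
  qed
  thus ?thesis using that unfolding P_def Q_def by metis
qed

text \<open>Subtracting a multiple of \<open>h\<close> clears coordinate \<open>j\<close>, so
  E_(j+1) is E_j plus the span of \<open>h\<close>.\<close>

lemma lead_space_Suc_subset_range: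
  assumes K: "K \<in> carrier_mat m m" and j: "j < m"
    and sub: "lead_space m j \<subseteq> (\<lambda>x. K *\<^sub>v x) ` carrier_vec m"
    and h: "h \<in> (\<lambda>x. K *\<^sub>v x) ` carrier_vec m" "h \<in> lead_space m (Suc j)" "h \<notin> lead_space m j"
  shows "lead_space m (Suc j) \<subseteq> (\<lambda>x. K *\<^sub>v x) ` carrier_vec m"
proof
  fix y assume y: "y \<in> lead_space m (Suc j)"
  note yc = lead_space_carrier[OF y] and hc = lead_space_carrier[OF h(2)]
  have hj: "h $ j \<noteq> 0" using h(2,3) by (rule lead_space_Suc_index_nonzero)
  define z where "z = y - (y $ j / h $ j) \<cdot>\<^sub>v h"
  have "z \<in> lead_space m j"
  proof (rule lead_spaceI)
    fix r assume "j \<le> r" "r < m"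
    thus "z $ r = 0"
      using hj yc hc lead_space_index[OF h(2), of r] lead_space_index[OF y, of r]
      by (cases "r = j") (auto simp: z_def)
  qed (use yc hc in \<open>auto simp: z_def\<close>)
  then obtain s t where st: "s \<in> carrier_vec m" "z = K *\<^sub>v s" "t \<in> carrier_vec m" "h = K *\<^sub>v t"
    using sub h(1) by blast
  have "y = z + (y $ j / h $ j) \<cdot>\<^sub>v h"
    using yc hc by (intro eq_vecI) (auto simp: z_def)
  also have "\<dots> = K *\<^sub>v (s + (y $ j / h $ j) \<cdot>\<^sub>v t)"
    using K st by (simp add: mult_add_distrib_mat_vec[OF K] mult_mat_vec[OF K])
  finally show "y \<in> (\<lambda>x. K *\<^sub>v x) ` carrier_vec m" using st by auto
qed

lemma inv_hessenberg_pencil_exists: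
  assumes m: "m \<noteq> 0"
    and rk: "\<And>j. 1 \<le> j \<Longrightarrow> j < m \<Longrightarrow> rank1_growth m B j"
  shows "\<exists>H K. inv_hessenberg m H \<and> inv_hessenberg m K \<and> invertible_mat K \<and> B * K = H"
proof -
  obtain g where g0: "g 0 = unit_vec m 0"
    and g: "\<And>j. j < m \<Longrightarrow> g j \<in> carrier_vec m" "\<And>j. j < m \<Longrightarrow> g j \<notin> lead_space m j"
    and Bg: "\<And>j. 1 \<le> j \<Longrightarrow> j < m \<Longrightarrow> B *\<^sub>v g j \<in> sum_space m B j"
    and step: "\<And>j. Suc j < m \<Longrightarrow> g (Suc j) = g j \<or> g j \<in> lead_space m (Suc j)"
    by (rule vector_sequence) (use rk m in \<open>(unfold rank1_growth_def, blast)+\<close>)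
  \<comment> \<open>A replaced vector was absorbed, and it stays in all later leading
    spaces.\<close>
  have g_cases: "g j = g i \<or> g j \<in> lead_space m i" if "j \<le> i" "i < m" for i j
    using that
  proof (induction i rule: dec_induct)
    case (step i)
    thus ?case using \<open>Suc i < m \<Longrightarrow> g (Suc i) = g i \<or> g i \<in> lead_space m (Suc i)\<close>
      lead_space_mono[of i "Suc i" m] by auto
  qed simp
  \<comment> \<open>The first \<open>j + 1\<close> columns are to span E_j and \<open>g j\<close>.
    If E_j absorbed \<open>g (j - 1)\<close>, the new vector is appended; otherwise
    \<open>g j = g (j - 1)\<close> is already present and \<open>unit_vec m (j - 1)\<close> supplies
    the missing direction of E_j.\<close>
  define k where "k j = (if j = 0 \<or> g (j - 1) \<in> lead_space m j then g j else unit_vec m (j - 1))" for j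
  define K where "K = mat_of_cols m (map k [0..<m])"
  have k: "k j \<in> carrier_vec m" if "j < m" for j using g(1)[OF that] by (auto simp: k_def)
  have K: "K \<in> carrier_mat m m" by (simp add: K_def mat_of_cols_def)
  have colK: "col K j = k j" if "j < m" for j
    using that k unfolding K_def by (subst col_mat_of_cols) auto
  have k_cases: "k j = g i \<or> k j \<in> lead_space m i" if "j \<le> i" "i < m" for i j
  proof (cases "j = 0 \<or> g (j - 1) \<in> lead_space m j")
    case True
    thus ?thesis using g_cases[OF that] by (simp add: k_def)
  next
    case False
    thus ?thesis using that by (auto simp: k_def intro!: unit_vec_lead_space)
  qed
  have rK: "lower_rank1 m i K" if i: "i < m" for i
  proof -
    \<comment> \<open>Columns in E_i vanish from row \<open>i\<close> on, so \<open>g i\<close> is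
      the column factor and \<open>c\<close> marks its occurrences.\<close>
    define c where "c s = (if k s = g i then 1 else 0 :: complex)" for s
    have "K $$ (r, s) = g i $ r * c s" if "i \<le> r" "r < m" "s \<le> i" for r s
    proof -
      have "K $$ (r, s) = k s $ r" using that i colK[of s] K by (metis carrier_matD index_col le_less_trans)
      thus ?thesis using k_cases[of s i] that i lead_space_index[of "k s" m i r] by (auto simp: c_def)
    qed
    thus ?thesis unfolding lower_rank1_def by blast
  qed
  have BK: "B * K \<in> carrier_mat m m" using B K by simp
  have BK_ix: "(B * K) $$ (r, s) = (B *\<^sub>v k s) $ r" if "r < m" "s < m" for r s
    using that B K colK[of s] by simp
  \<comment> \<open>The block for \<open>i = 0\<close> is a single column. For larger
    \<open>i\<close>, all images \<open>B *\<^sub>v k s\<close> with \<open>s \<le> i\<close> lie in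
    \<open>sum_space m B i\<close> and hence are multiples of one \<open>w\<close> from row
    \<open>i\<close> on.\<close>
  have rH: "lower_rank1 m i (B * K)" if i: "i < m" for i
  proof (cases "i = 0")
    case True
    thus ?thesis unfolding lower_rank1_def
      by (intro exI[of _ "\<lambda>r. (B * K) $$ (r, 0)"] exI[of _ "\<lambda>_. 1"]) auto
  next
    case False
    hence i1: "1 \<le> i" by simp
    have "B *\<^sub>v k s \<in> sum_space m B i" if "s \<le> i" for s
      using k_cases[OF that i] Bg[OF i1 i] mult_in_sum_space by auto
    with rk[OF i1 i, unfolded rank1_growth_def] obtain w where
      "\<forall>s. \<exists>\<alpha>. s \<le> i \<longrightarrow> (\<forall>r. i \<le> r \<and> r < m \<longrightarrow> (B *\<^sub>v k s) $ r = \<alpha> * w $ r)" by metis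
    then obtain c where
      "\<And>s r. s \<le> i \<Longrightarrow> i \<le> r \<Longrightarrow> r < m \<Longrightarrow> (B *\<^sub>v k s) $ r = c s * w $ r" by metis
    hence "(B * K) $$ (r, s) = w $ r * c s" if "i \<le> r" "r < m" "s \<le> i" for r s
      using that i BK_ix[of r s] by (simp add: mult.commute)
    thus ?thesis unfolding lower_rank1_def by blast
  qed
  let ?rg = "(\<lambda>x. K *\<^sub>v x) ` carrier_vec m"
  have k_range: "k j \<in> ?rg" if "j < m" for j
  proof -
    have "K *\<^sub>v unit_vec m j = k j"
      using that K colK[OF that] by (intro eq_vecI) (auto simp flip: colK)
    thus ?thesis by (metis image_eqI unit_vec_carrier)
  qed
  \<comment> \<open>If \<open>g j\<close> is absorbed, it enlarges E_j to E_(j+1); otherwise it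
    equals \<open>g (Suc j)\<close> and \<open>unit_vec m j\<close> does the enlarging. Hence the
    invariant carries \<open>g j\<close> along.\<close>
  have range: "lead_space m j \<subseteq> ?rg \<and> g j \<in> ?rg" if "j < m" for j
    using that
  proof (induction j)
    case 0
    have "lead_space m 0 \<subseteq> {0\<^sub>v m}" by (auto simp: lead_space_def)
    moreover have "0\<^sub>v m \<in> ?rg" using K by (intro image_eqI[of _ _ "0\<^sub>v m"]) auto
    moreover have "g 0 = k 0" by (simp add: k_def)
    ultimately show ?case using k_range[OF 0] by auto
  next
    case (Suc j)
    hence IH: "lead_space m j \<subseteq> ?rg" "g j \<in> ?rg" and j: "j < m" by auto
    show ?case
    proof (cases "g j \<in> lead_space m (Suc j)")
      case True
      have "g (Suc j) = k (Suc j)" using True by (simp add: k_def)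
      thus ?thesis
        using lead_space_Suc_subset_range[OF K j IH True g(2)[OF j]] k_range[OF Suc.prems] by simp
    next
      case False
      have "unit_vec m j \<in> ?rg" using False k_range[OF Suc.prems] by (simp add: k_def)
      moreover have "unit_vec m j \<notin> lead_space m j" using j by (auto simp: lead_space_def)
      ultimately show ?thesis
        using lead_space_Suc_subset_range[OF K j IH(1) _ unit_vec_lead_space[of j "Suc j" m]]
          step[OF Suc.prems] False IH(2) by auto
    qed
  qed
  obtain n where n: "m = Suc n" using m by (cases m) auto
  have lm: "lead_space m m = carrier_vec m" by (auto simp: lead_space_def)
  \<comment> \<open>The invariant ends at index \<open>m - 1\<close>; one last enlargement by
    \<open>g n\<close> fills the whole space.\<close>
  have "lead_space m (Suc n) \<subseteq> ?rg"
    by (rule lead_space_Suc_subset_range[OF K, of n "g n"]) (use range[of n] g[of n] n lm in auto)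
  hence "carrier_vec m \<subseteq> ?rg" using lm n by metis
  hence "invertible_mat K" by (rule invertible_if_surjective[OF K])
  moreover have "inv_hessenberg m K" by (rule inv_hessenberg_if_lower_rank1[OF K m rK])
  moreover have "inv_hessenberg m (B * K)" by (rule inv_hessenberg_if_lower_rank1[OF BK m rH])
  ultimately show ?thesis by blast
qed

end

subsection \<open>Rational Krylov spaces in coordinates\<close>

lemma rank1_sum_space_infinite:
  assumes B: "B \<in> carrier_mat m m" and j: "j < m"
    and up: "\<And>y. y \<in> lead_space m j \<Longrightarrow> B *\<^sub>v y \<in> lead_space m (Suc j)"
    and ex: "\<exists>y \<in> lead_space m j. B *\<^sub>v y \<notin> lead_space m j"
  shows "rank1_growth m B j"
proof -
  have up': "sum_space m B j \<subseteq> lead_space m (Suc j)"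
    using up subsetD[OF lead_space_mono[of j "Suc j" m]]
    by (auto simp: sum_space_def intro!: lead_space_add)
  obtain w where w: "w \<in> sum_space m B j" "w \<notin> lead_space m j"
    using ex mult_in_sum_space[OF B] by blast
  have z: "y $ r = 0" if "y \<in> sum_space m B j" "j < r" "r < m" for y r
    using that up' lead_space_index[of y m "Suc j" r] by auto
  \<comment> \<open>Inside E_(j+1) only coordinate \<open>j\<close> survives modulo E_j, so it
    determines the factor.\<close>
  have "w $ j \<noteq> 0" using up' w by (intro lead_space_Suc_index_nonzero) auto
  hence "y $ r = (y $ j / w $ j) * w $ r" if "y \<in> sum_space m B j" "j \<le> r" "r < m" for y r
    using that z[OF that(1), of r] z[OF w(1), of r] by (cases "r = j") auto
  thus ?thesis using w unfolding rank1_growth_def by blast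
qed

lemma mult_combination:
  assumes "N \<in> carrier_mat m m" "x \<in> carrier_vec m" "y \<in> carrier_vec m" "z \<in> carrier_vec m"
  shows "N *\<^sub>v (x + a \<cdot>\<^sub>v y + b \<cdot>\<^sub>v z) = N *\<^sub>v x + a \<cdot>\<^sub>v (N *\<^sub>v y) + b \<cdot>\<^sub>v (N *\<^sub>v (z :: complex vec))"
proof -
  have "x + a \<cdot>\<^sub>v y \<in> carrier_vec m" "a \<cdot>\<^sub>v y \<in> carrier_vec m" "b \<cdot>\<^sub>v z \<in> carrier_vec m"
    using assms by auto
  thus ?thesis
    using assms by (simp only: mult_add_distrib_mat_vec[OF assms(1)] mult_mat_vec[OF assms(1)])
qed

lemma mult_vec_index_lead:
  assumes "M \<in> carrier_mat m m" "j \<le> m" "i < m"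
  shows "(M *\<^sub>v vec m (\<lambda>k. if k < j then c k else 0)) $ i = (\<Sum>k<j. M $$ (i, k) * c k)"
proof -
  have "(M *\<^sub>v vec m (\<lambda>k. if k < j then c k else 0)) $ i
      = (\<Sum>k\<in>{0..<m}. M $$ (i, k) * (if k < j then c k else 0))"
    using assms by (simp add: scalar_prod_def)
  also have "\<dots> = (\<Sum>k<j. M $$ (i, k) * c k)"
    using assms(2) by (intro sum.mono_neutral_cong_right) auto
  finally show ?thesis .
qed

text \<open>The vectors \<open>M e\<^sub>1, \<dots>, M e\<^sub>j, x, x'\<close> lie in the \<open>(j+1)\<close>-dimensional leading space,
  so they are dependent; applying \<open>N\<close> to the relation makes the images of \<open>x\<close> and \<open>x'\<close>
  dependent modulo the leading space of dimension \<open>j\<close>.\<close>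

lemma inverse_images_dependent:
  assumes N: "N \<in> carrier_mat m m" and M: "M \<in> carrier_mat m m" and NM: "N * M = 1\<^sub>m m"
    and j: "j < m"
    and up: "\<And>y. y \<in> lead_space m j \<Longrightarrow> M *\<^sub>v y \<in> lead_space m (Suc j)"
    and x: "x \<in> lead_space m j" "x' \<in> lead_space m j"
  obtains a b where "a \<noteq> 0 \<or> b \<noteq> 0"
    and "\<And>r. j \<le> r \<Longrightarrow> r < m \<Longrightarrow> a * (N *\<^sub>v x) $ r + b * (N *\<^sub>v x') $ r = 0"
proof -
  \<comment> \<open>There are \<open>j\<close> coefficients for columns of \<open>M\<close> and two
    for \<open>x\<close> and \<open>x'\<close>, against \<open>j + 1\<close> possibly nonzero
    coordinates.\<close>
  define A where "A i k = (if k < j then M $$ (i, k) else if k = j then x $ i else x' $ i)" for i k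
  obtain c where c: "\<exists>k\<le>Suc j. c k \<noteq> 0" "\<And>i. i < Suc j \<Longrightarrow> (\<Sum>k\<le>Suc j. A i k * c k) = 0"
    using underdetermined_solution[where a = A and n = "Suc j"] by blast
  define u where "u = vec m (\<lambda>k. if k < j then c k else 0)"
  have u: "u \<in> lead_space m j" by (auto simp: u_def lead_space_def)
  note uc = lead_space_carrier[OF u] and xc = lead_space_carrier[OF x(1)] lead_space_carrier[OF x(2)]
  define s where "s = M *\<^sub>v u + c j \<cdot>\<^sub>v x + c (Suc j) \<cdot>\<^sub>v x'"
  have sm: "s \<in> lead_space m (Suc j)"
    unfolding s_def using x lead_space_mono[of j "Suc j" m] up[OF u]
    by (intro lead_space_add lead_space_smult) auto
  have "s = 0\<^sub>v m"
  proof (rule eq_vecI)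
    fix i assume "i < dim_vec (0\<^sub>v m :: complex vec)"
    hence i: "i < m" by simp
    show "s $ i = 0\<^sub>v m $ i"
    proof (cases "i < Suc j")
      case True
      have "(M *\<^sub>v u) $ i = (\<Sum>k<j. A i k * c k)"
        unfolding u_def using mult_vec_index_lead[OF M _ i] j by (simp add: A_def)
      hence "s $ i = (\<Sum>k<j. A i k * c k) + x $ i * c j + x' $ i * c (Suc j)"
        using i M xc unfolding s_def by (simp add: mult.commute del: index_mult_mat_vec)
      also have "\<dots> = (\<Sum>k\<le>Suc j. A i k * c k)"
        by (simp add: lessThan_Suc_atMost[symmetric] A_def)
      finally show ?thesis using c(2)[OF True] i by simp
    next
      case False
      thus ?thesis using lead_space_index[OF sm, of i] i by simp
    qed
  qed (use lead_space_carrier[OF sm] in auto)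
  hence "N *\<^sub>v s = 0\<^sub>v m" using N by auto
  moreover have "N *\<^sub>v (M *\<^sub>v u) = u"
    using assoc_mult_mat_vec[OF N M uc] uc by (simp add: NM)
  moreover have "M *\<^sub>v u \<in> carrier_vec m" by (rule mult_mat_vec_carrier[OF M uc])
  ultimately have rel: "u + c j \<cdot>\<^sub>v (N *\<^sub>v x) + c (Suc j) \<cdot>\<^sub>v (N *\<^sub>v x') = 0\<^sub>v m"
    unfolding s_def using mult_combination[OF N _ xc] by metis
  have rel_ix: "u $ r + c j * (N *\<^sub>v x) $ r + c (Suc j) * (N *\<^sub>v x') $ r = 0" if "r < m" for r
  proof -
    have "(u + c j \<cdot>\<^sub>v (N *\<^sub>v x) + c (Suc j) \<cdot>\<^sub>v (N *\<^sub>v x')) $ r = 0" using rel that by simp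
    thus ?thesis using that N uc by (simp del: index_mult_mat_vec)
  qed
  show ?thesis
  proof (rule that[of "c j" "c (Suc j)"])
    \<comment> \<open>If both vanish, the relation reduces to \<open>u = 0\<^sub>v m\<close>, and
      all coefficients are zero.\<close>
    show "c j \<noteq> 0 \<or> c (Suc j) \<noteq> 0"
    proof (rule ccontr)
      assume z: "\<not> ?thesis"
      hence "c k = 0" if "k < j" for k
        using rel_ix[of k] that j by (simp add: u_def)
      thus False using c(1) z by (metis le_SucE le_neq_implies_less)
    qed
  next
    fix r assume "j \<le> r" "r < m"
    thus "c j * (N *\<^sub>v x) $ r + c (Suc j) * (N *\<^sub>v x') $ r = 0"
      using rel_ix[of r] by (simp add: u_def)
  qed
qed

text \<open>If \<open>N\<close> left E_j invariant, it would map all of E_(j+1) into E_j: that space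
  is E_j plus the span of some \<open>M *\<^sub>v y\<close>, which \<open>N\<close> takes back to
  \<open>y\<close>. This drop in dimension contradicts invertibility.\<close>

lemma inverse_not_invariant:
  assumes N: "N \<in> carrier_mat m m" and M: "M \<in> carrier_mat m m"
    and NM: "N * M = 1\<^sub>m m" and j: "j < m"
    and up: "\<And>y. y \<in> lead_space m j \<Longrightarrow> M *\<^sub>v y \<in> lead_space m (Suc j)"
    and ex: "\<exists>y \<in> lead_space m j. M *\<^sub>v y \<notin> lead_space m j"
  shows "\<exists>y \<in> lead_space m j. N *\<^sub>v y \<notin> lead_space m j"
proof (rule ccontr)
  assume "\<not> ?thesis"
  hence inv: "\<And>y. y \<in> lead_space m j \<Longrightarrow> N *\<^sub>v y \<in> lead_space m j" by blast
  have MN: "M * N = 1\<^sub>m m" by (rule mat_mult_left_right_inverse[OF N M NM])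
  obtain y where y: "y \<in> lead_space m j" "M *\<^sub>v y \<notin> lead_space m j" using ex by blast
  have My: "M *\<^sub>v y \<in> lead_space m (Suc j)" by (rule up[OF y(1)])
  have Myj: "(M *\<^sub>v y) $ j \<noteq> 0" using My y(2) by (rule lead_space_Suc_index_nonzero)
  have inv_Suc: "N *\<^sub>v x \<in> lead_space m j" if x: "x \<in> lead_space m (Suc j)" for x
  proof -
    define a where "a = x $ j / (M *\<^sub>v y) $ j"
    define z where "z = x - a \<cdot>\<^sub>v (M *\<^sub>v y)"
    note xc = lead_space_carrier[OF x] and Mc = lead_space_carrier[OF My] and yc = lead_space_carrier[OF y(1)]
    have z: "z \<in> lead_space m j"
    proof (rule lead_spaceI)
      fix r assume r: "j \<le> r" "r < m"
      have "z $ r = x $ r - a * (M *\<^sub>v y) $ r" using r xc Mc M by (simp add: z_def del: index_mult_mat_vec)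
      thus "z $ r = 0"
        using Myj r lead_space_index[OF My, of r] lead_space_index[OF x, of r]
        by (cases "r = j") (auto simp: a_def simp del: index_mult_mat_vec)
    qed (use xc Mc in \<open>auto simp: z_def\<close>)
    have "x = z + a \<cdot>\<^sub>v (M *\<^sub>v y)"
      using xc Mc M by (intro eq_vecI) (auto simp: z_def simp del: index_mult_mat_vec)
    hence "N *\<^sub>v x = N *\<^sub>v z + a \<cdot>\<^sub>v (N *\<^sub>v (M *\<^sub>v y))"
      using N Mc lead_space_carrier[OF z] by (simp add: mult_add_distrib_mat_vec[OF N] mult_mat_vec[OF N])
    also have "N *\<^sub>v (M *\<^sub>v y) = y"
      using assoc_mult_mat_vec[OF N M yc] yc by (simp add: NM)
    finally show ?thesis using inv[OF z] y(1) by (simp add: lead_space_add lead_space_smult)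
  qed
  \<comment> \<open>The \<open>j\<close> equations in \<open>j + 1\<close> unknowns yield a nonzero
    \<open>u\<close> in E_(j+1) with \<open>N *\<^sub>v u = 0\<^sub>v m\<close>, as the remaining
    coordinates of the image vanish by \<open>inv_Suc\<close>.\<close>
  obtain c where c: "\<exists>k\<le>j. c k \<noteq> 0" "\<And>i. i < j \<Longrightarrow> (\<Sum>k\<le>j. N $$ (i, k) * c k) = 0"
    using underdetermined_solution[where a = "\<lambda>i k. N $$ (i, k)" and n = j] by blast
  define u where "u = vec m (\<lambda>k. if k < Suc j then c k else 0)"
  have u: "u \<in> lead_space m (Suc j)" by (auto simp: u_def lead_space_def)
  note uc = lead_space_carrier[OF u]
  have "N *\<^sub>v u = 0\<^sub>v m"
  proof (rule eq_vecI)
    fix i assume "i < dim_vec (0\<^sub>v m :: complex vec)"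
    hence i: "i < m" by simp
    have "(N *\<^sub>v u) $ i = 0"
    proof (cases "i < j")
      case True
      have "(N *\<^sub>v u) $ i = (\<Sum>k<Suc j. N $$ (i, k) * c k)"
        unfolding u_def by (rule mult_vec_index_lead[OF N _ i]) (use j in auto)
      also have "\<dots> = 0" using c(2)[OF True] by (simp only: lessThan_Suc_atMost)
      finally show ?thesis .
    next
      case False
      thus ?thesis using lead_space_index[OF inv_Suc[OF u], of i] i by simp
    qed
    thus "(N *\<^sub>v u) $ i = 0\<^sub>v m $ i" using i by simp
  qed (use N in auto)
  moreover have "M *\<^sub>v (N *\<^sub>v u) = u"
    using assoc_mult_mat_vec[OF M N uc] uc by (simp add: MN)
  ultimately have u0: "u = 0\<^sub>v m" using M by auto
  have "c k = 0" if "k \<le> j" for k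
  proof -
    have "u $ k = 0" using u0 that j by simp
    thus ?thesis using that j by (simp add: u_def)
  qed
  thus False using c(1) by blast
qed

text \<open>The shift by \<open>z\<close> does not change the sum of E_j and its image, so
  \<open>B\<close> may be replaced by the inverse of \<open>M\<close>, to which the two preceding
  lemmas apply.\<close>

lemma rank1_sum_space_finite:
  assumes B: "B \<in> carrier_mat m m" and M: "M \<in> carrier_mat m m"
    and NM: "(B - z \<cdot>\<^sub>m 1\<^sub>m m) * M = 1\<^sub>m m" and j: "j < m"
    and up: "\<And>y. y \<in> lead_space m j \<Longrightarrow> M *\<^sub>v y \<in> lead_space m (Suc j)"
    and ex: "\<exists>y \<in> lead_space m j. M *\<^sub>v y \<notin> lead_space m j"
  shows "rank1_growth m B j"
proof -
  define N where "N = B - z \<cdot>\<^sub>m 1\<^sub>m m"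
  have N: "N \<in> carrier_mat m m" using B unfolding N_def by (intro minus_carrier_mat smult_carrier_mat one_carrier_mat)
  note NM' = NM[folded N_def]
  have Nx: "N *\<^sub>v x = B *\<^sub>v x - z \<cdot>\<^sub>v x" if "x \<in> carrier_vec m" for x
  proof -
    have "(z \<cdot>\<^sub>m 1\<^sub>m m) *\<^sub>v x = z \<cdot>\<^sub>v x" using that by (intro eq_vecI) auto
    thus ?thesis
      unfolding N_def using minus_mult_distrib_mat_vec[OF B _ that, of "z \<cdot>\<^sub>m 1\<^sub>m m"] by simp
  qed
  obtain x where x: "x \<in> lead_space m j" "N *\<^sub>v x \<notin> lead_space m j"
    using inverse_not_invariant[OF N M NM' j up ex] by blast
  note xc = lead_space_carrier[OF x(1)]
  have "N *\<^sub>v x = (- z) \<cdot>\<^sub>v x + 1 \<cdot>\<^sub>v (B *\<^sub>v x)"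
    unfolding Nx[OF xc] using xc B by (intro eq_vecI) auto
  also have "\<dots> \<in> sum_space m B j"
    by (rule sum_space_smult_add[OF B lead_space_smult[OF x(1)] mult_in_sum_space[OF B x(1)]])
  finally have W: "N *\<^sub>v x \<in> sum_space m B j" .
  have "\<exists>\<alpha>. \<forall>r. j \<le> r \<and> r < m \<longrightarrow> y $ r = \<alpha> * (N *\<^sub>v x) $ r" if y: "y \<in> sum_space m B j" for y
  proof -
    from y obtain s t where st: "y = s + B *\<^sub>v t" "s \<in> lead_space m j" "t \<in> lead_space m j"
      unfolding sum_space_def by blast
    note sc = lead_space_carrier[OF st(2)] and tc = lead_space_carrier[OF st(3)]
    obtain a b where ab: "a \<noteq> 0 \<or> b \<noteq> 0"
      "\<And>r. j \<le> r \<Longrightarrow> r < m \<Longrightarrow> a * (N *\<^sub>v x) $ r + b * (N *\<^sub>v t) $ r = 0"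
      using inverse_images_dependent[OF N M NM' j up x(1) st(3)] by blast
    \<comment> \<open>A relation with \<open>b = 0\<close> would put \<open>N *\<^sub>v x\<close>
      into E_j, contrary to the choice of \<open>x\<close>.\<close>
    have b: "b \<noteq> 0"
    proof
      assume "b = 0"
      hence "(N *\<^sub>v x) $ r = 0" if "j \<le> r" "r < m" for r using ab(1) ab(2)[OF that] by simp
      thus False using x(2) N xc by (auto intro!: lead_spaceI)
    qed
    have "y $ r = (- a / b) * (N *\<^sub>v x) $ r" if r: "j \<le> r" "r < m" for r
    proof -
      have "(N *\<^sub>v t) $ r = (B *\<^sub>v t) $ r - z * t $ r"
        unfolding Nx[OF tc] using r B tc by (simp del: index_mult_mat_vec)
      hence "y $ r = (N *\<^sub>v t) $ r"
        using lead_space_index[OF st(2) r] lead_space_index[OF st(3) r] r B sc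
        unfolding st(1) by (simp del: index_mult_mat_vec)
      moreover have "b * (N *\<^sub>v t) $ r = - a * (N *\<^sub>v x) $ r"
        using ab(2)[OF r] by (simp add: eq_neg_iff_add_eq_0 add.commute del: index_mult_mat_vec)
      ultimately show ?thesis using b by (simp add: field_simps del: index_mult_mat_vec)
    qed
    thus ?thesis by blast
  qed
  thus ?thesis using W x(2) unfolding rank1_growth_def by blast
qed

section \<open>Transfer of the Krylov recursion to coordinates\<close>

lemma cspan_take_cols:
  assumes V: "V \<in> carrier_mat m m" and j: "j \<le> m"
  shows "cspan m (set (take j (cols V))) = (\<lambda>x. V *\<^sub>v x) ` lead_space m j"
proof -
  interpret vec_space "TYPE(complex)" m .
  define ws where "ws = take j (cols V)"
  have len: "length ws = j" using V j by (simp add: ws_def)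
  have ws: "set ws \<subseteq> carrier_vec m"
    using V cols_dim[of V] set_take_subset[of j "cols V"] by (auto simp: ws_def)
  have wsk: "ws ! k = col V k" if "k < j" for k using that V j by (simp add: ws_def)
  \<comment> \<open>Zero padding to length \<open>m\<close> turns combinations of the first
    \<open>j\<close> columns into images of vectors in E_j.\<close>
  have pad: "mat_of_cols m ws *\<^sub>v vec j c = V *\<^sub>v vec m (\<lambda>k. if k < j then c k else 0)" for c
  proof (rule eq_vecI)
    fix i assume "i < dim_vec (V *\<^sub>v vec m (\<lambda>k. if k < j then c k else 0))"
    hence i: "i < m" using V by simp
    have "(mat_of_cols m ws *\<^sub>v vec j c) $ i = (\<Sum>k\<in>{0..<j}. mat_of_cols m ws $$ (i, k) * c k)"
      using i len by (simp add: scalar_prod_def)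
    also have "\<dots> = (\<Sum>k<j. V $$ (i, k) * c k)"
      using i len wsk V j by (intro sum.cong) (auto simp: mat_of_cols_index)
    finally show "(mat_of_cols m ws *\<^sub>v vec j c) $ i
        = (V *\<^sub>v vec m (\<lambda>k. if k < j then c k else 0)) $ i"
      using mult_vec_index_lead[OF V j i] by simp
  qed (use V in simp)
  have lc: "lincomb_list c ws = V *\<^sub>v vec m (\<lambda>k. if k < j then c k else 0)" for c
  proof -
    have "\<forall>w \<in> set ws. dim_vec w = m" using ws by auto
    from lincomb_list_as_mat_mult[OF this] show ?thesis by (simp only: len pad)
  qed
  have "cspan m (set ws) = span_list ws"
    unfolding cspan_def by (rule span_list_as_span[OF ws, symmetric])
  also have "\<dots> = range (\<lambda>c. V *\<^sub>v vec m (\<lambda>k. if k < j then c k else 0))"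
    unfolding span_list_def lc by (auto simp: class_ring_simps)
  also have "\<dots> = (\<lambda>x. V *\<^sub>v x) ` lead_space m j"
  proof (intro equalityI subsetI)
    fix y assume "y \<in> (\<lambda>x. V *\<^sub>v x) ` lead_space m j"
    then obtain x where x: "x \<in> lead_space m j" "y = V *\<^sub>v x" by blast
    have "x = vec m (\<lambda>k. if k < j then x $ k else 0)"
      using lead_space_index[OF x(1)] lead_space_carrier[OF x(1)] by (intro eq_vecI) auto
    hence "y = V *\<^sub>v vec m (\<lambda>k. if k < j then x $ k else 0)" using x(2) by simp
    thus "y \<in> range (\<lambda>c. V *\<^sub>v vec m (\<lambda>k. if k < j then c k else 0))" by (intro range_eqI[of _ _ "\<lambda>k. x $ k"])
  qed (auto simp: lead_space_def)
  finally show ?thesis by (simp add: ws_def)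
qed

text \<open>The shifted matrix has nonzero determinant, so \<open>mat_inverse\<close> returns a
  \<open>Some\<close> and \<open>the\<close> yields a true inverse.\<close>

lemma krylov_op_inverse:
  assumes A: "A \<in> carrier_mat m m" and z: "\<not> eigenvalue A z"
  shows "krylov_op A (Some z) \<in> carrier_mat m m"
    and "(A - z \<cdot>\<^sub>m 1\<^sub>m m) * krylov_op A (Some z) = 1\<^sub>m m"
proof -
  define N where "N = A - z \<cdot>\<^sub>m 1\<^sub>m m"
  have N: "N \<in> carrier_mat m m" using A unfolding N_def by (intro minus_carrier_mat smult_carrier_mat one_carrier_mat)
  have "char_matrix A z = N"
    using A by (intro eq_matI) (auto simp: char_matrix_def N_def)
  hence "det N \<noteq> 0" using z eigenvalue_det[OF A] by simp
  hence "N \<in> Units (ring_mat TYPE(complex) m ())" by (rule det_non_zero_imp_unit[OF N])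
  with mat_inverse(1)[OF N, where b = "()"] obtain M where M: "mat_inverse N = Some M"
    by (cases "mat_inverse N") auto
  from mat_inverse(2)[OF N M] have "N * M = 1\<^sub>m m" "M \<in> carrier_mat m m" by auto
  thus "krylov_op A (Some z) \<in> carrier_mat m m" "(A - z \<cdot>\<^sub>m 1\<^sub>m m) * krylov_op A (Some z) = 1\<^sub>m m"
    using A M by (simp_all add: krylov_op_def N_def)
qed

theorem theorem3p3:
  fixes m :: nat and A V :: "complex mat" and v :: "complex vec" and \<xi> :: "nat \<Rightarrow> pole"
  assumes A: "A \<in> carrier_mat m m"
    and v: "v \<in> carrier_vec m" "vec_norm2 v = 1"
    and poles: "\<And>i z. i \<in> {1..m - 1} \<Longrightarrow> \<xi> i = Some z \<Longrightarrow> \<not> eigenvalue A z"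
    and no_breakdown: "\<And>k. k \<in> {1..m} \<Longrightarrow> csubspace_dim m (rat_krylov A v \<xi> k) = k"
    and V: "orthonormal_nested_basis m A v \<xi> V"
  shows "\<exists>H K. inv_hessenberg m H \<and> inv_hessenberg m K \<and> invertible_mat K \<and>
           mat_adjoint V * A * V * K = H"
proof -
  \<comment> \<open>The empty vector has norm 0, not 1.\<close>
  have m: "m \<noteq> 0"
  proof
    assume "m = 0"
    hence "dim_vec v = 0" using v(1) by simp
    thus False using v(2) by (simp add: vec_norm2_def)
  qed
  have Vc: "V \<in> carrier_mat m m" and VV: "mat_adjoint V * V = 1\<^sub>m m"
    and nested: "\<And>i. i \<in> {1..m} \<Longrightarrow> cspan m (set (take i (cols V))) = rat_krylov A v \<xi> i"
    using V by (auto simp: orthonormal_nested_basis_def)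
  define W where "W = mat_adjoint V"
  have W: "W \<in> carrier_mat m m" using Vc by (auto simp: W_def)
  have WV: "W * V = 1\<^sub>m m" using VV by (simp add: W_def)
  have VW: "V * W = 1\<^sub>m m" by (rule mat_mult_left_right_inverse[OF W Vc WV])
  have WVx: "W *\<^sub>v (V *\<^sub>v x) = x" if "x \<in> carrier_vec m" for x
    using assoc_mult_mat_vec[OF W Vc that] that by (simp add: WV)
  have kry: "rat_krylov A v \<xi> i = (\<lambda>x. V *\<^sub>v x) ` lead_space m i" if "1 \<le> i" "i \<le> m" for i
    using nested[of i] cspan_take_cols[OF Vc that(2)] that by simp
  define B where "B = W * A * V"
  have B: "B \<in> carrier_mat m m" using W A Vc by (simp add: B_def)
  have "rank1_growth m B j" if j1: "1 \<le> j" and j: "j < m" for j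
  proof -
    define L where "L = krylov_op A (\<xi> j)"
    have pole: "\<not> eigenvalue A z" if "\<xi> j = Some z" for z using poles[of j z] that j1 j by auto
    have L: "L \<in> carrier_mat m m"
      using krylov_op_inverse(1)[OF A pole] A
      by (cases "\<xi> j") (auto simp: L_def krylov_op_def)
    \<comment> \<open>This is the Krylov operator in the coordinates of \<open>V\<close>;
      \<open>rec\<close> and \<open>coord\<close> express the recursion as E_(j+1) = E_j + M
      E_j.\<close>
    define M where "M = W * L * V"
    have M: "M \<in> carrier_mat m m" using W L Vc by (simp add: M_def)
    have Mx: "M *\<^sub>v x = W *\<^sub>v (L *\<^sub>v (V *\<^sub>v x))" if "x \<in> carrier_vec m" for x
    proof -
      have Vx: "V *\<^sub>v x \<in> carrier_vec m" and WL: "W * L \<in> carrier_mat m m" using Vc W L that by auto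
      show ?thesis
        unfolding M_def assoc_mult_mat_vec[OF WL Vc that] assoc_mult_mat_vec[OF W L Vx] ..
    qed
    obtain n where n: "j = Suc n" using j1 by (cases j) auto
    have rec: "(\<lambda>x. V *\<^sub>v x) ` lead_space m (Suc j)
      = {V *\<^sub>v x + L *\<^sub>v (V *\<^sub>v y) | x y. x \<in> lead_space m j \<and> y \<in> lead_space m j}"
    proof -
      have "(\<lambda>x. V *\<^sub>v x) ` lead_space m (Suc j) = rat_krylov A v \<xi> (Suc j)"
        using kry[of "Suc j"] j by simp
      also have "\<dots> = {x + L *\<^sub>v y | x y. x \<in> rat_krylov A v \<xi> j \<and> y \<in> rat_krylov A v \<xi> j}"
        by (simp add: n L_def)
      also have "\<dots> = {V *\<^sub>v x + L *\<^sub>v (V *\<^sub>v y) | x y. x \<in> lead_space m j \<and> y \<in> lead_space m j}"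
        using kry[of j] j1 j by auto
      finally show ?thesis .
    qed
    have coord: "x + M *\<^sub>v y = x'"
      if "V *\<^sub>v x' = V *\<^sub>v x + L *\<^sub>v (V *\<^sub>v y)" "x \<in> carrier_vec m" "y \<in> carrier_vec m" "x' \<in> carrier_vec m"
      for x y x'
    proof -
      have "x' = W *\<^sub>v (V *\<^sub>v x + L *\<^sub>v (V *\<^sub>v y))" using WVx[OF that(4)] that(1) by simp
      also have "\<dots> = W *\<^sub>v (V *\<^sub>v x) + W *\<^sub>v (L *\<^sub>v (V *\<^sub>v y))"
        using Vc L that by (intro mult_add_distrib_mat_vec[OF W]) auto
      finally show ?thesis using WVx[OF that(2)] Mx[OF that(3)] by simp
    qed
    have up: "M *\<^sub>v y \<in> lead_space m (Suc j)" if y: "y \<in> lead_space m j" for y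
    proof -
      have "V *\<^sub>v 0\<^sub>v m + L *\<^sub>v (V *\<^sub>v y) \<in> (\<lambda>x. V *\<^sub>v x) ` lead_space m (Suc j)"
        unfolding rec using y lead_space_zero by blast
      then obtain x' where x': "x' \<in> lead_space m (Suc j)"
        "V *\<^sub>v x' = V *\<^sub>v 0\<^sub>v m + L *\<^sub>v (V *\<^sub>v y)" by (metis imageE)
      have "0\<^sub>v m + M *\<^sub>v y = x'"
        by (rule coord[OF x'(2)]) (use lead_space_carrier y x'(1) in auto)
      thus ?thesis using x'(1) mult_mat_vec_carrier[OF M lead_space_carrier[OF y]] by simp
    qed
    \<comment> \<open>Otherwise the recursion stays in E_j and misses
      \<open>unit_vec m j\<close>.\<close>
    have ex: "\<exists>y \<in> lead_space m j. M *\<^sub>v y \<notin> lead_space m j"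
    proof (rule ccontr)
      assume neg: "\<not> ?thesis"
      have "V *\<^sub>v unit_vec m j \<in> (\<lambda>x. V *\<^sub>v x) ` lead_space m (Suc j)"
        by (intro imageI unit_vec_lead_space) simp
      then obtain x y where xy: "x \<in> lead_space m j" "y \<in> lead_space m j"
        "V *\<^sub>v unit_vec m j = V *\<^sub>v x + L *\<^sub>v (V *\<^sub>v y)" unfolding rec by blast
      have "x + M *\<^sub>v y = unit_vec m j"
        by (rule coord[OF xy(3)]) (use lead_space_carrier xy in auto)
      hence "unit_vec m j \<in> lead_space m j" using neg xy lead_space_add by metis
      thus False using j lead_space_index[of "unit_vec m j" m j j] by simp
    qed
    show ?thesis
    proof (cases "\<xi> j")
      case None
      hence "M = B" by (simp add: M_def B_def L_def krylov_op_def)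
      thus ?thesis using rank1_sum_space_infinite[OF B j] up ex by simp
    next
      case (Some z)
      define N where "N = A - z \<cdot>\<^sub>m 1\<^sub>m m"
      have N: "N \<in> carrier_mat m m" using A unfolding N_def by (intro minus_carrier_mat smult_carrier_mat one_carrier_mat)
      have NL: "N * L = 1\<^sub>m m"
        using krylov_op_inverse(2)[OF A pole[OF Some]] by (simp add: L_def N_def Some)
      \<comment> \<open>Since \<open>W\<close> and \<open>V\<close> are mutually inverse,
        conjugation carries the inverse pair \<open>N\<close>, \<open>L\<close> to the pair of the
        shifted \<open>B\<close> and \<open>M\<close>.\<close>
      have "W * N * V = W * A * V - W * (z \<cdot>\<^sub>m 1\<^sub>m m) * V"
        unfolding N_def using W A Vc
        by (simp add: mult_minus_distrib_mat[of _ m m _ m] minus_mult_distrib_mat[of _ m m _ _ m])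
      also have "W * (z \<cdot>\<^sub>m 1\<^sub>m m) * V = z \<cdot>\<^sub>m 1\<^sub>m m"
        using W Vc WV by (simp add: mult_smult_distrib[of _ m m _ m] mult_smult_assoc_mat[of _ m m _ m])
      finally have BN: "B - z \<cdot>\<^sub>m 1\<^sub>m m = W * N * V" by (simp add: B_def)
      have "(W * N * V) * (W * L * V) = W * N * (V * (W * L * V))"
        using W N Vc L by (intro assoc_mult_mat) auto
      also have "V * (W * L * V) = (V * W) * (L * V)"
        using W L Vc by (simp add: assoc_mult_mat[of _ m m _ m _ m])
      also have "\<dots> = L * V" using L Vc by (simp add: VW)
      also have "W * N * (L * V) = W * ((N * L) * V)"
        using W N L Vc by (simp add: assoc_mult_mat[of _ m m _ m _ m])
      also have "\<dots> = 1\<^sub>m m" using Vc by (simp add: NL WV)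
      finally have "(B - z \<cdot>\<^sub>m 1\<^sub>m m) * M = 1\<^sub>m m" by (simp add: BN M_def)
      thus ?thesis using rank1_sum_space_finite[OF B M _ j] up ex by blast
    qed
  qed
  from inv_hessenberg_pencil_exists[OF B m this] show ?thesis by (simp add: B_def W_def)
qed

end
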